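(* Let $\frac{1}{\sqrt2}\le s<1$ and $c=\sqrt{1-s^2}$. Let $\mathcal{H}=\mathbb{C}^2$, let $M=\mathbb{C}\begin{bmatrix} 1 \\ 0 \end{bmatrix}$ and $N=\mathbb{C}\begin{bmatrix} c \\ s \end{bmatrix}$, and define the nests $\mathcal{M}=\{\{0\},M,\mathcal{H}\}$ and $\mathcal{N}=\{\{0\},N,\mathcal{H}\}$. Then $d(\mathcal{M},\mathcal{N}) = s<1$, but $d(\mathcal{T}(\mathcal{M}),\mathcal{T}(\mathcal{N}))=1$.
   Context: For a closed subspace $N$ of a Hilbert space $\mathcal{H}$, $P_N$ denotes the orthogonal projection onto $N$. For a nest $\mathcal{N}$ (here a finite chain of subspaces containing $\{0\}$ and $\mathcal{H}$), the nest algebra is $\mathcal{T}(\mathcal{N}) = \{T\in\mathcal{B}(\mathcal{H}) : TN\subseteq N \text{ for all } N\in\mathcal{N}\}$. The distance between two nests is $$d(\mathcal{M},\mathcal{N}) = \max\Big\{ \sup_{N\in\mathcal{N}}\inf_{M\in\mathcal{M}}\|P_N-P_M\|,\ \sup_{M\in\mathcal{M}}\inf_{N\in\mathcal{N}}\|P_N-P_M\|\Big\}.$$ The distance between two operator algebras $\mathcal{A},\mathcal{B}\subseteq\mathcal{B}(\mathcal{H})$ is $$d(\mathcal{A},\mathcal{B}) = \max\Big\{ \sup_{A\in b_1(\mathcal{A})}\inf_{B\in\mathcal{B}}\|A-B\|,\ \sup_{B\in b_1(\mathcal{B})}\inf_{A\in\mathcal{A}}\|A-B\|\Big\},$$ where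 $b_1(\cdot)$ denotes the closed unit ball, and all norms are operator norms. *)

theory Defs
  imports "HOL-Analysis.Analysis"
begin

text \<open>
  The Hilbert space is \<^typ>\<open>complex ^ 'n\<close>, whose library norm is the Euclidean one.  The library
  inner product on this type is the real part of the Hermitian one, so the latter is defined here.
\<close>

definition herm_inner :: "complex ^ 'n \<Rightarrow> complex ^ 'n \<Rightarrow> complex" where
  "herm_inner x y = (\<Sum>i\<in>UNIV. x $ i * cnj (y $ i))"

text \<open>Intended for complex-linear subspaces \<open>N\<close>, for which the described vector exists uniquely.\<close>

definition orth_proj :: "(complex ^ 'n) set \<Rightarrow> complex ^ 'n \<Rightarrow> complex ^ 'n" where
  "orth_proj N x = (THE y. y \<in> N \<and> (\<forall>z\<in>N. herm_inner (x - y) z = 0))"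

text \<open>
  \<^const>\<open>bounded_linear\<close> refers to real scalars only; complex homogeneity has to be
  required separately.
\<close>

definition bounded_operators :: "(complex ^ 'n \<Rightarrow> complex ^ 'n) set" where
  "bounded_operators = {T. bounded_linear T \<and> Vector_Spaces.linear (*s) (*s) T}"

definition nest_algebra :: "(complex ^ 'n) set set \<Rightarrow> (complex ^ 'n \<Rightarrow> complex ^ 'n) set" where
  "nest_algebra \<N> = {T \<in> bounded_operators. \<forall>N\<in>\<N>. T ` N \<subseteq> N}"

definition op_dist :: "(complex ^ 'n \<Rightarrow> complex ^ 'n) \<Rightarrow> (complex ^ 'n \<Rightarrow> complex ^ 'n) \<Rightarrow> real" where
  "op_dist S T = onorm (\<lambda>x. S x - T x)"

text \<open>
  The suprema and infima below are real-valued.  They are those of nonempty bounded sets whenever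
  the arguments are nonempty sets of subspaces, or linear spaces of bounded operators, respectively.
\<close>

definition nest_dist :: "(complex ^ 'n) set set \<Rightarrow> (complex ^ 'n) set set \<Rightarrow> real" where
  "nest_dist \<M> \<N> =
     max (SUP N\<in>\<N>. INF M\<in>\<M>. op_dist (orth_proj N) (orth_proj M))
         (SUP M\<in>\<M>. INF N\<in>\<N>. op_dist (orth_proj N) (orth_proj M))"

definition op_unit_ball ::
    "(complex ^ 'n \<Rightarrow> complex ^ 'n) set \<Rightarrow> (complex ^ 'n \<Rightarrow> complex ^ 'n) set" where
  "op_unit_ball \<A> = {T \<in> \<A>. onorm T \<le> 1}"

definition algebra_dist ::
    "(complex ^ 'n \<Rightarrow> complex ^ 'n) set \<Rightarrow> (complex ^ 'n \<Rightarrow> complex ^ 'n) set \<Rightarrow> real" where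
  "algebra_dist \<A> \<B> =
     max (SUP A\<in>op_unit_ball \<A>. INF B\<in>\<B>. op_dist A B)
         (SUP B\<in>op_unit_ball \<B>. INF A\<in>\<A>. op_dist A B)"

end

theory Submission
  imports Defs
begin

text \<open>
  Both projections are explicit, and their difference is \<open>s\<close> times a reflection.  Put \<open>t = c / s\<close>,
  so \<open>t \<le> 1\<close>.  The upper triangular matrix with rows \<open>(t, 1 - t\<^sup>2)\<close> and \<open>(0, - t)\<close> is a contraction
  carrying the unit vector \<open>(c, s)\<close> of \<open>N\<close> to the unit vector \<open>(s, - c)\<close> of the orthogonal complement
  of \<open>N\<close>.  Every operator leaving \<open>N\<close> invariant keeps \<open>(c, s)\<close> in \<open>N\<close>, hence is at distance at
  least \<open>1\<close> from it; comparing with \<open>0\<close> shows that the distance never exceeds \<open>1\<close>.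
\<close>

section \<open>Coordinates and orthogonal projections\<close>

text \<open>Real and imaginary parts are grouped because the matrices below have real entries and
  act on the two parts separately. Each norm estimate then follows from a real identity or
  inequality in two variables, applied once to each part.\<close>

lemma norm_complex_vec2_squared:
  fixes x :: "complex ^ 2"
  shows "(norm x)\<^sup>2 = ((Re (x $ 1))\<^sup>2 + (Re (x $ 2))\<^sup>2) + ((Im (x $ 1))\<^sup>2 + (Im (x $ 2))\<^sup>2)"
  by (simp add: norm_vec_def L2_set_def sum_2 cmod_power2)

lemma orth_proj_zero: "orth_proj {0} = (\<lambda>x. 0)"
  by (auto simp: orth_proj_def herm_inner_def fun_eq_iff)

lemma herm_inner_self_eq_0_iff: "herm_inner x x = 0 \<longleftrightarrow> x = 0"
proof -
  have "herm_inner x x = of_real (\<Sum>i\<in>UNIV. (cmod (x $ i))\<^sup>2)"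
    by (simp add: herm_inner_def complex_norm_square del: of_real_power)
  then show ?thesis
    by (simp only: of_real_eq_0_iff) (auto simp: sum_nonneg_eq_0_iff vec_eq_iff)
qed

lemma orth_proj_UNIV: "orth_proj UNIV = (\<lambda>x. x)"
proof
  fix x :: "complex ^ 'n"
  \<comment> \<open>Orthogonality is tested against \<open>x - y\<close> itself.\<close>
  have "y = x" if "\<forall>z. herm_inner (x - y) z = 0" for y
    using that herm_inner_self_eq_0_iff[of "x - y"] by simp
  then show "orth_proj UNIV x = x"
    unfolding orth_proj_def by (intro the_equality) (auto simp: herm_inner_def)
qed

lemma herm_inner_diff_left: "herm_inner (x - y) z = herm_inner x z - herm_inner y z"
  by (simp add: herm_inner_def left_diff_distrib sum_subtractf)

lemma herm_inner_scale_left: "herm_inner (k *s x) y = k * herm_inner x y"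
  by (simp add: herm_inner_def sum_distrib_left mult.assoc)

lemma herm_inner_scale_right: "herm_inner x (k *s y) = cnj k * herm_inner x y"
  by (simp add: herm_inner_def sum_distrib_left mult.left_commute)

lemma orth_proj_span_unit:
  assumes "herm_inner v v = 1"
  shows "orth_proj (vec.span {v}) = (\<lambda>x. herm_inner x v *s v)"
proof
  fix x
  show "orth_proj (vec.span {v}) x = herm_inner x v *s v"
    unfolding orth_proj_def
    \<comment> \<open>For uniqueness, a candidate \<open>k *s v\<close> is tested against
      \<open>v\<close>, the multiple with scalar \<open>1\<close>; this forces
      \<open>k = herm_inner x v\<close>.\<close>
    by (rule the_equality)
       (use assms in \<open>auto simp: vec.span_singleton herm_inner_diff_left herm_inner_scale_left
          herm_inner_scale_right vec.scale_eq_0_iff dest: spec[of _ 1]\<close>)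
qed

lemma orth_proj_real_line:
  fixes c s :: real
  assumes "c\<^sup>2 + s\<^sup>2 = 1"
  shows "orth_proj (vec.span {vector [complex_of_real c, complex_of_real s] :: complex ^ 2}) =
    (\<lambda>x. (c * x $ 1 + s * x $ 2) *s vector [complex_of_real c, complex_of_real s])"
proof -
  have "herm_inner (vector [complex_of_real c, complex_of_real s] :: complex ^ 2)
      (vector [complex_of_real c, complex_of_real s]) = of_real (c\<^sup>2 + s\<^sup>2)"
    by (simp add: herm_inner_def sum_2 power2_eq_square)
  then show ?thesis
    using assms by (subst orth_proj_span_unit)
      (auto simp: herm_inner_def sum_2 mult.commute)
qed

section \<open>Operator norms of differences of projections\<close>

lemma onorm_eqI:
  fixes f :: "'a :: {real_normed_vector, perfect_space} \<Rightarrow> 'b :: real_normed_vector"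
  assumes "bounded_linear f" "\<And>x. norm (f x) \<le> b * norm x" "norm (f x) = b * norm x" "x \<noteq> 0"
  shows "onorm f = b"
proof (rule antisym)
  show "onorm f \<le> b"
    by (rule onorm_le) (rule assms(2))
  have "b * norm x \<le> onorm f * norm x"
    using onorm[OF assms(1), of x] assms(3) by simp
  then show "b \<le> onorm f"
    using assms(4) by simp
qed

lemma bounded_linear_vec_scale_left: "bounded_linear (\<lambda>k :: complex. k *s v)"
  unfolding linear_conv_bounded_linear[symmetric]
  by (intro linearI) (auto simp: vec_eq_iff distrib_right)

lemma bounded_linear_coordinate_projection:
  "bounded_linear (\<lambda>x :: complex ^ 2. (a * x $ 1 + b * x $ 2) *s v)"
  by (intro bounded_linear_compose[OF bounded_linear_vec_scale_left] bounded_linear_add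
      bounded_linear_const_mult bounded_linear_vec_nth)

lemma op_dist_commute: "op_dist S T = op_dist T S"
  unfolding op_dist_def by (simp add: onorm_def norm_minus_commute)

lemma op_dist_self: "op_dist S S = 0"
  by (simp add: op_dist_def onorm_zero)

lemma op_dist_zero_id: "op_dist (\<lambda>x :: complex ^ 'n. 0) (\<lambda>x. x) = 1"
  by (simp add: op_dist_def onorm_neg onorm_id[unfolded id_def])

lemma op_dist_zero_real_line:
  fixes c s :: real
  assumes "c\<^sup>2 + s\<^sup>2 = 1"
  shows "op_dist (\<lambda>x. 0)
    (orth_proj (vec.span {vector [complex_of_real c, complex_of_real s] :: complex ^ 2})) = 1"
proof -
  let ?v = "vector [complex_of_real c, complex_of_real s] :: complex ^ 2"
  have real_le: "((c * a + s * b) * c)\<^sup>2 + ((c * a + s * b) * s)\<^sup>2 \<le> a\<^sup>2 + b\<^sup>2" for a b :: real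
  proof -
    \<comment> \<open>Pythagoras: the defect is the squared component along the orthogonal unit
      vector \<open>(s, - c)\<close>.\<close>
    have "a\<^sup>2 + b\<^sup>2 - (((c * a + s * b) * c)\<^sup>2 + ((c * a + s * b) * s)\<^sup>2) = (s * a - c * b)\<^sup>2"
      using assms by algebra
    then show ?thesis by (metis diff_ge_0_iff_ge zero_le_power2)
  qed
  have "norm ((c * x $ 1 + s * x $ 2) *s ?v) \<le> 1 * norm x" for x :: "complex ^ 2"
  proof -
    have "(norm ((c * x $ 1 + s * x $ 2) *s ?v))\<^sup>2 \<le> (norm x)\<^sup>2"
      unfolding norm_complex_vec2_squared
      using add_mono[OF real_le[of "Re (x $ 1)" "Re (x $ 2)"] real_le[of "Im (x $ 1)" "Im (x $ 2)"]]
      by (simp add: distrib_right)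
    then show ?thesis by (simp add: power2_le_iff_abs_le)
  qed
  moreover have "(c * ?v $ 1 + s * ?v $ 2) *s ?v = ?v"
  proof -
    have "c * ?v $ 1 + s * ?v $ 2 = of_real (c\<^sup>2 + s\<^sup>2)" by (simp add: power2_eq_square)
    then show ?thesis using assms by simp
  qed
  moreover have "?v \<noteq> 0"
    using assms by (auto simp: vec_eq_iff forall_2)
  ultimately have "onorm (\<lambda>x :: complex ^ 2. (c * x $ 1 + s * x $ 2) *s ?v) = 1"
    by (intro onorm_eqI[where x = ?v] bounded_linear_coordinate_projection) simp_all
  then show ?thesis
    unfolding orth_proj_real_line[OF assms]
    by (subst op_dist_commute) (simp only: op_dist_def diff_zero)
qed

lemma op_dist_id_real_line:
  fixes c s :: real
  assumes "c\<^sup>2 + s\<^sup>2 = 1"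
  shows "op_dist (\<lambda>x. x)
    (orth_proj (vec.span {vector [complex_of_real c, complex_of_real s] :: complex ^ 2})) = 1"
proof -
  let ?v = "vector [complex_of_real c, complex_of_real s] :: complex ^ 2"
  \<comment> \<open>\<open>?w\<close> spans the orthogonal complement of the line, so the
    complementary projection fixes it and attains its norm there.\<close>
  let ?w = "vector [complex_of_real s, complex_of_real (- c)] :: complex ^ 2"
  have real_le: "(a - (c * a + s * b) * c)\<^sup>2 + (b - (c * a + s * b) * s)\<^sup>2 \<le> a\<^sup>2 + b\<^sup>2" for a b :: real
  proof -
    have "a\<^sup>2 + b\<^sup>2 - ((a - (c * a + s * b) * c)\<^sup>2 + (b - (c * a + s * b) * s)\<^sup>2) = (c * a + s * b)\<^sup>2"
      using assms by algebra
    then show ?thesis by (metis diff_ge_0_iff_ge zero_le_power2)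
  qed
  have "norm (x - (c * x $ 1 + s * x $ 2) *s ?v) \<le> 1 * norm x" for x :: "complex ^ 2"
  proof -
    have "(norm (x - (c * x $ 1 + s * x $ 2) *s ?v))\<^sup>2 \<le> (norm x)\<^sup>2"
      unfolding norm_complex_vec2_squared
      using add_mono[OF real_le[of "Re (x $ 1)" "Re (x $ 2)"] real_le[of "Im (x $ 1)" "Im (x $ 2)"]]
      by (simp add: distrib_right)
    then show ?thesis by (simp add: power2_le_iff_abs_le)
  qed
  moreover have "?w - (c * ?w $ 1 + s * ?w $ 2) *s ?v = ?w"
    by (simp add: mult.commute)
  moreover have "?w \<noteq> 0"
    using assms by (auto simp: vec_eq_iff forall_2)
  ultimately have "onorm (\<lambda>x :: complex ^ 2. x - (c * x $ 1 + s * x $ 2) *s ?v) = 1"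
    by (intro onorm_eqI[where x = ?w] bounded_linear_sub bounded_linear_ident
        bounded_linear_coordinate_projection) simp_all
  then show ?thesis
    unfolding orth_proj_real_line[OF assms] op_dist_def .
qed

text \<open>Since \<open>c\<^sup>2 - 1 = - s\<^sup>2\<close>, the difference is \<open>s\<close>
  times the matrix with rows \<open>(- s, c)\<close> and \<open>(c, s)\<close>, which is orthogonal.
  It therefore scales every norm by exactly \<open>s\<close>, and any nonzero vector can serve as
  the witness for \<open>onorm_eqI\<close>.\<close>

lemma op_dist_real_lines:
  fixes c s :: real
  assumes "c\<^sup>2 + s\<^sup>2 = 1" "0 \<le> s"
  shows "op_dist
    (orth_proj (vec.span {vector [complex_of_real c, complex_of_real s] :: complex ^ 2}))
    (orth_proj (vec.span {vector [1, 0]})) = s"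
proof -
  let ?v = "vector [complex_of_real c, complex_of_real s] :: complex ^ 2"
  let ?D = "\<lambda>x :: complex ^ 2. (c * x $ 1 + s * x $ 2) *s ?v - (x $ 1) *s vector [1, 0]"
  have real_eq: "((c * a + s * b) * c - a)\<^sup>2 + ((c * a + s * b) * s)\<^sup>2 = s\<^sup>2 * (a\<^sup>2 + b\<^sup>2)" for a b :: real
    using assms(1) by algebra
  have norm_D: "norm (?D x) = s * norm x" for x :: "complex ^ 2"
  proof -
    have "(norm (?D x))\<^sup>2 = (s * norm x)\<^sup>2"
      unfolding norm_complex_vec2_squared power_mult_distrib
      using real_eq[of "Re (x $ 1)" "Re (x $ 2)"] real_eq[of "Im (x $ 1)" "Im (x $ 2)"]
      by (simp add: distrib_left distrib_right)
    then show ?thesis using assms(2) by (simp add: power2_eq_iff_nonneg)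
  qed
  have "bounded_linear ?D"
    using bounded_linear_coordinate_projection[of 1 0]
    by (intro bounded_linear_sub bounded_linear_coordinate_projection) simp
  then have "onorm ?D = s"
    by (intro onorm_eqI[where x = "vector [1, 0]"])
       (simp_all only: norm_D order_refl, simp add: vec_eq_iff forall_2)
  then show ?thesis
    using orth_proj_real_line[of 1 0]
    unfolding orth_proj_real_line[OF assms(1)] op_dist_def by simp
qed

section \<open>Distance between the nests\<close>

text \<open>The members \<open>{0}\<close> and \<open>UNIV\<close> lie in both nests and contribute
  infimum \<open>0\<close>. Each line contributes the minimum of \<open>1\<close>, \<open>d\<close>
  and \<open>1\<close>, which is \<open>d\<close> because \<open>d \<le> 1\<close>; the maximum with
  \<open>0\<close> is again \<open>d\<close>.\<close>

lemma nest_dist_lines: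
  fixes L K :: "(complex ^ 'n) set"
  assumes "op_dist (\<lambda>x. 0) (orth_proj L) = 1" "op_dist (\<lambda>x. x) (orth_proj L) = 1"
    and "op_dist (\<lambda>x. 0) (orth_proj K) = 1" "op_dist (\<lambda>x. x) (orth_proj K) = 1"
    and "op_dist (orth_proj K) (orth_proj L) = d" "0 \<le> d" "d \<le> 1"
  shows "nest_dist {{0}, L, UNIV} {{0}, K, UNIV} = d"
proof -
  have [simp]: "op_dist (orth_proj L) (\<lambda>x. 0) = 1" "op_dist (orth_proj L) (\<lambda>x. x) = 1"
    "op_dist (orth_proj K) (\<lambda>x. 0) = 1" "op_dist (orth_proj K) (\<lambda>x. x) = 1"
    "op_dist (\<lambda>x :: complex ^ 'n. x) (\<lambda>x. 0) = 1"
    using assms op_dist_zero_id by (metis op_dist_commute)+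
  show ?thesis
    using assms by (simp add: nest_dist_def cSup_eq_Max cInf_eq_Min orth_proj_zero orth_proj_UNIV
        op_dist_self op_dist_zero_id)
qed

section \<open>Distance between operator algebras\<close>

lemma nest_algebra_bounded_linear: "T \<in> nest_algebra \<N> \<Longrightarrow> bounded_linear T"
  by (simp add: nest_algebra_def bounded_operators_def)

lemma zero_in_nest_algebra:
  assumes "\<And>N. N \<in> \<N> \<Longrightarrow> 0 \<in> N"
  shows "(\<lambda>x. 0) \<in> nest_algebra \<N>"
  using assms by (auto simp: nest_algebra_def bounded_operators_def bounded_linear_zero
      intro!: vec.linear_zero)

lemma op_dist_nonneg:
  "\<lbrakk>bounded_linear S; bounded_linear T\<rbrakk> \<Longrightarrow> 0 \<le> op_dist S T"
  unfolding op_dist_def by (intro onorm_pos_le bounded_linear_sub)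

text \<open>The zero operator is a competitor at distance \<open>onorm A\<close>. Nonnegativity of
  \<open>op_dist\<close> bounds the set of distances below, as the real-valued infimum
  requires.\<close>

lemma INF_op_dist_le:
  assumes "bounded_linear A" "\<And>B. B \<in> \<B> \<Longrightarrow> bounded_linear B" "(\<lambda>x. 0) \<in> \<B>"
  shows "(INF B\<in>\<B>. op_dist A B) \<le> onorm A"
proof -
  have "bdd_below (op_dist A ` \<B>)"
    using assms by (auto intro!: bdd_belowI[of _ 0] op_dist_nonneg)
  then have "(INF B\<in>\<B>. op_dist A B) \<le> op_dist A (\<lambda>x. 0)"
    using assms(3) by (rule cINF_lower)
  then show ?thesis by (simp add: op_dist_def)
qed

text \<open>Both suprema are at most \<open>1\<close>, so a single operator of one unit ball far
  from the other algebra settles the maximum; the second supremum needs only its upper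
  bound.\<close>

lemma algebra_dist_eq_1I:
  assumes "\<And>A. A \<in> \<A> \<Longrightarrow> bounded_linear A" "(\<lambda>x. 0) \<in> \<A>"
    and "\<And>B. B \<in> \<B> \<Longrightarrow> bounded_linear B" "(\<lambda>x. 0) \<in> \<B>"
    and "A \<in> \<A>" "onorm A \<le> 1" "\<And>B. B \<in> \<B> \<Longrightarrow> 1 \<le> op_dist A B"
  shows "algebra_dist \<A> \<B> = 1"
proof -
  have le1: "(INF B\<in>\<B>. op_dist A B) \<le> 1" if "A \<in> op_unit_ball \<A>" for A
    using that assms(1,3,4) INF_op_dist_le[of A \<B>] by (fastforce simp: op_unit_ball_def)
  have le2: "(INF A\<in>\<A>. op_dist A B) \<le> 1" if "B \<in> op_unit_ball \<B>" for B
    using that assms(1-3) INF_op_dist_le[of B \<A>]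
    by (fastforce simp: op_unit_ball_def op_dist_commute[of _ B])
  \<comment> \<open>These memberships also show that both unit balls are nonempty, as bounding the
    real suprema above requires.\<close>
  have A: "A \<in> op_unit_ball \<A>" and z: "(\<lambda>x. 0) \<in> op_unit_ball \<B>"
    using assms by (auto simp: op_unit_ball_def onorm_zero)
  have "1 \<le> (INF B\<in>\<B>. op_dist A B)"
    using assms by (intro cINF_greatest) auto
  also have "\<dots> \<le> (SUP A\<in>op_unit_ball \<A>. INF B\<in>\<B>. op_dist A B)"
    using le1 by (intro cSUP_upper[OF A] bdd_aboveI[of _ 1]) auto
  finally have "1 \<le> (SUP A\<in>op_unit_ball \<A>. INF B\<in>\<B>. op_dist A B)" .
  moreover have "(SUP A\<in>op_unit_ball \<A>. INF B\<in>\<B>. op_dist A B) \<le> 1"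
    using A le1 by (intro cSUP_least) auto
  moreover have "(SUP B\<in>op_unit_ball \<B>. INF A\<in>\<A>. op_dist A B) \<le> 1"
    using z le2 by (intro cSUP_least) auto
  ultimately show ?thesis by (simp add: algebra_dist_def)
qed

section \<open>The extremal contraction\<close>

text \<open>For \<open>t = c / s\<close> all entries are forced. A contraction \<open>A\<close>
  carrying the unit vector \<open>v = (c, s)\<close> to the unit vector \<open>w = (s, - c)\<close>
  has an adjoint carrying \<open>w\<close> to \<open>v\<close>; for triangular \<open>A\<close> this
  makes the upper left entry \<open>c / s\<close>. The equation \<open>A v = w\<close> then gives
  the second column.\<close>

definition extremal_matrix :: "real \<Rightarrow> complex ^ 2 ^ 2" where
  "extremal_matrix t = vector [vector [of_real t, of_real (1 - t\<^sup>2)], vector [0, of_real (- t)]]"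

lemma extremal_matrix_mult:
  "(extremal_matrix t *v x) $ 1 = of_real t * x $ 1 + of_real (1 - t\<^sup>2) * x $ 2"
  "(extremal_matrix t *v x) $ 2 = - of_real t * x $ 2"
  by (simp_all add: extremal_matrix_def matrix_vector_mult_def sum_2)

lemma onorm_extremal_matrix_le:
  assumes "0 \<le> t" "t \<le> 1"
  shows "onorm ((*v) (extremal_matrix t)) \<le> 1"
proof (rule onorm_le)
  fix x :: "complex ^ 2"
  have real_ineq: "(t * a + (1 - t\<^sup>2) * b)\<^sup>2 + (t * b)\<^sup>2 \<le> a\<^sup>2 + b\<^sup>2" for a b :: real
  proof -
    \<comment> \<open>The identity minus transpose times matrix has rank at most one, with quadratic
      form on the right; its sign is that of \<open>1 - t\<^sup>2\<close>.\<close>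
    have "a\<^sup>2 + b\<^sup>2 - ((t * a + (1 - t\<^sup>2) * b)\<^sup>2 + (t * b)\<^sup>2) = (1 - t\<^sup>2) * (a - t * b)\<^sup>2"
      by algebra
    also have "\<dots> \<ge> 0"
      using assms by (simp add: power_le_one)
    finally show ?thesis by simp
  qed
  have "(norm (extremal_matrix t *v x))\<^sup>2 \<le> (norm x)\<^sup>2"
    unfolding norm_complex_vec2_squared extremal_matrix_mult
    using add_mono[OF real_ineq[of "Re (x $ 1)" "Re (x $ 2)"] real_ineq[of "Im (x $ 1)" "Im (x $ 2)"]]
    by (simp del: of_real_diff)
  then show "norm (extremal_matrix t *v x) \<le> 1 * norm x"
    by (simp add: power2_le_iff_abs_le)
qed

lemma extremal_matrix_in_nest_algebra:
  "(*v) (extremal_matrix t) \<in> nest_algebra {{0}, vec.span {vector [1, 0]}, UNIV}"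
proof -
  have "extremal_matrix t *v (k *s vector [1, 0]) = (t * k) *s vector [1, 0]" for k :: complex
    by (simp add: vec_eq_iff forall_2 extremal_matrix_mult)
  then show ?thesis
    by (auto simp: nest_algebra_def bounded_operators_def vec.span_singleton
        matrix_vector_mul_linear_gen)
qed

lemma op_dist_extremal_matrix_ge:
  assumes "c\<^sup>2 + s\<^sup>2 = 1" "s \<noteq> 0"
    and B: "B \<in> nest_algebra {{0}, vec.span {vector [complex_of_real c, complex_of_real s]}, UNIV}"
  shows "1 \<le> op_dist ((*v) (extremal_matrix (c / s))) B"
proof -
  let ?v = "vector [complex_of_real c, complex_of_real s] :: complex ^ 2"
  let ?A = "extremal_matrix (c / s)"
  have "B ?v \<in> vec.span {?v}"
    using B vec.span_base[of ?v "{?v}"] by (auto simp: nest_algebra_def)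
  then obtain k where k: "B ?v = k *s ?v"
    by (auto simp: vec.span_singleton)
  \<comment> \<open>First coordinate of \<open>?A *v ?v\<close>, computed over the reals before
    embedding.\<close>
  have "c / s * c + (1 - (c / s)\<^sup>2) * s = (c\<^sup>2 + s\<^sup>2 - c\<^sup>2) / s"
    using assms(2) by (simp add: field_simps power2_eq_square)
  also have "\<dots> = s"
    using assms(2) by (simp add: power2_eq_square)
  finally have e: "c / s * c + (1 - (c / s)\<^sup>2) * s = s" .
  have A1: "(?A *v ?v) $ 1 = of_real s"
    by (subst e[symmetric]) (simp add: extremal_matrix_mult)
  have A2: "(?A *v ?v) $ 2 = - of_real c"
    using assms(2) by (simp add: extremal_matrix_mult)
  \<comment> \<open>Pythagoras: \<open>?A *v ?v\<close> is orthogonal to \<open>k *s ?v\<close>, so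
    the cross terms cancel.\<close>
  have "(norm (?A *v ?v - B ?v))\<^sup>2 = (c\<^sup>2 + s\<^sup>2) * (1 + (Re k)\<^sup>2 + (Im k)\<^sup>2)"
    by (simp add: k norm_complex_vec2_squared A1 A2) algebra
  also have "\<dots> \<ge> 1" using assms(1) by simp
  finally have "1 \<le> norm (?A *v ?v - B ?v)"
    by (simp add: power2_nonneg_ge_1_iff)
  also have "\<dots> \<le> op_dist ((*v) ?A) B * norm ?v"
    unfolding op_dist_def
    by (rule onorm) (use nest_algebra_bounded_linear[OF B] in
      \<open>auto intro!: bounded_linear_sub matrix_vector_mul_bounded_linear\<close>)
  also have "norm ?v = 1"
    using assms(1) norm_complex_vec2_squared[of ?v] norm_ge_zero[of ?v]
    by (auto simp: power2_eq_1_iff)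
  finally show ?thesis by simp
qed

theorem mainTheorem4:
  fixes s c :: real
    and M N :: "(complex ^ 2) set"
    and \<M> \<N> :: "(complex ^ 2) set set"
  assumes "1 / sqrt 2 \<le> s" and "s < 1"
    and "c = sqrt (1 - s\<^sup>2)"
    and "M = vec.span {vector [1, 0]}"
    and "N = vec.span {vector [complex_of_real c, complex_of_real s]}"
    and "\<M> = {{0}, M, UNIV}"
    and "\<N> = {{0}, N, UNIV}"
  shows "nest_dist \<M> \<N> = s \<and> s < 1 \<and>
         algebra_dist (nest_algebra \<M>) (nest_algebra \<N>) = 1"
proof -
  have s0: "0 < s"
    using assms(1) by (smt (verit) real_sqrt_gt_0_iff zero_less_divide_1_iff)
  have c0: "0 \<le> c" and cs: "c\<^sup>2 + s\<^sup>2 = 1"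
    using assms(2,3) s0 by (auto simp: power_le_one)
  \<comment> \<open>The bound \<open>s\<^sup>2 \<ge> 1 / 2\<close> gives
    \<open>c\<^sup>2 \<le> 1 / 2 \<le> s\<^sup>2\<close>, hence \<open>c / s \<le> 1\<close>, the
    condition for \<open>extremal_matrix (c / s)\<close> to be a contraction.\<close>
  have "(1 / sqrt 2)\<^sup>2 \<le> s\<^sup>2"
    using assms(1) by (intro power_mono) auto
  then have "c\<^sup>2 \<le> s\<^sup>2"
    using cs by (simp add: power_divide)
  then have "c \<le> s"
    using s0 by (auto intro: power2_le_imp_le)
  then have t: "0 \<le> c / s" "c / s \<le> 1"
    using c0 s0 by auto
  \<comment> \<open>\<open>M\<close> is rewritten as the real line with parameters \<open>1\<close>
    and \<open>0\<close>, so that the lemmas for \<open>N\<close> apply to it too.\<close>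
  have M: "M = vec.span {vector [complex_of_real 1, complex_of_real 0]}"
    using assms(4) by simp
  have "nest_dist \<M> \<N> = s"
    unfolding assms(6,7)
  proof (rule nest_dist_lines)
    show "op_dist (\<lambda>x. 0) (orth_proj M) = 1" "op_dist (\<lambda>x. x) (orth_proj M) = 1"
      unfolding M by (rule op_dist_zero_real_line op_dist_id_real_line; simp)+
    show "op_dist (\<lambda>x. 0) (orth_proj N) = 1" "op_dist (\<lambda>x. x) (orth_proj N) = 1"
      unfolding assms(5) using cs by (rule op_dist_zero_real_line op_dist_id_real_line)+
    show "op_dist (orth_proj N) (orth_proj M) = s"
      unfolding assms(4,5) using cs s0 by (intro op_dist_real_lines) auto
  qed (use s0 assms(2) in auto)
  moreover have "algebra_dist (nest_algebra \<M>) (nest_algebra \<N>) = 1"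
  proof (rule algebra_dist_eq_1I)
    show "(\<lambda>x. 0) \<in> nest_algebra \<M>" "(\<lambda>x. 0) \<in> nest_algebra \<N>"
      by (rule zero_in_nest_algebra; auto simp: assms vec.span_zero)+
    show "(*v) (extremal_matrix (c / s)) \<in> nest_algebra \<M>"
      unfolding assms(4,6) by (rule extremal_matrix_in_nest_algebra)
    show "onorm ((*v) (extremal_matrix (c / s))) \<le> 1"
      using t by (rule onorm_extremal_matrix_le)
    show "1 \<le> op_dist ((*v) (extremal_matrix (c / s))) B" if "B \<in> nest_algebra \<N>" for B
      using that cs s0 unfolding assms(5,7) by (intro op_dist_extremal_matrix_ge) auto
  qed (auto intro: nest_algebra_bounded_linear)
  ultimately show ?thesis using assms(2) by blast
qed

end
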